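(* Let $E$ be a real Banach space, let $X\subset E$ be a closed convex set and let $Y$ be a convex set in a topological vector space. Let $I,J:E\times Y\to\mathbb{R}$ and $\alpha,\beta:E\to\mathbb{R}$. Assume that $\alpha$ and $I(\cdot,y)$ (for each $y\in Y$) are Gâteaux differentiable at each point of $X$, and that $\beta$ and $J(\cdot,y)$ (for each $y\in Y$) are $C^1$ in $E$. Assume also that $$\sup_{y\in Y}\inf_{x\in X}(I(x,y)-J(x,y))<\inf_{x\in X}\sup_{y\in Y}(I(x,y)-J(x,y))$$ and that $$\sup_X(\alpha+\beta)-\inf_X(\alpha+\beta)<\inf_{x\in X}\sup_{y\in Y}(I(x,y)-J(x,y))-\sup_{y\in Y}\inf_{x\in X}(I(x,y)-J(x,y)).$$ Moreover, suppose that the following conditions are satisfied: $(i_1)$ for each $y\in Y$, the function $I(\cdot,y)+\alpha(\cdot)$ is lower semicontinuous and convex in $E$; $(i_2)$ there exists a topology $\tau$ on $X$ such that, for each $y\in Y$, the function $I(\cdot,y)-J(\cdot,y)+\alpha(\cdot)+\beta(\cdot)$ is $\tau$-lower semicontinuous and $\tau$-inf-compact in $X$; $(i_3)$ for each $x\in X$, the function $I(x,\cdot)-J(x,\cdot)$ is continuous and quasi-concave in $Y$; $(i_4)$ for each $y\in Y$, and for each $u\in X$ such that $$I(u,y)-J(u,y)+\alpha(u)+\beta(u)=\inf_{x\in X}(I(x,y)-J(x,y)+\alpha(x)+\beta(x)),$$ the triple $(X,\,J(\cdot,y)-\beta(\cdot),\,I(\cdot,y)+\alpha(\cdot))$ satisfies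 the pointwise invariant condition at the point $u$. Then, for each convex set $S\subseteq Y$, dense in $Y$, there exists $\tilde y\in S$ such that the equation $$I'_x(x,\tilde y)-J'_x(x,\tilde y)+\alpha'(x)+\beta'(x)=0$$ has at least two solutions in $X$.
   Context: Primes denote (Gâteaux) derivatives, which are elements of the dual space $E^*$; $I'_x(x,y)$ and $J'_x(x,y)$ denote the derivatives at $x$ of $I(\cdot,y)$ and $J(\cdot,y)$. Pointwise invariant condition: if $\Phi,\Psi:E\to\mathbb{R}$ are Gâteaux differentiable at each point of $X$, the triple $(X,\Phi,\Psi)$ satisfies the pointwise invariant condition at a point $u_0\in X$ if at least one of the following two facts holds: (a) there exist $v_0\in X$ and a lower semicontinuous convex Gâteaux differentiable functional $\gamma:E\to\mathbb{R}$ such that $\Phi'(u_0)+\gamma'(u_0)=\Psi'(v_0)+\gamma'(v_0)$; (b) there exist $v_0\in X$ and a lower semicontinuous convex Gâteaux differentiable functional $\gamma:E\to\mathbb{R}$, with $\gamma'(0)=0$, such that $\Phi'(u_0)=\Psi'(v_0)+\gamma'(v_0-u_0)$. A function $f:X\to\mathbb{R}$ is $\tau$-inf-compact if $\{x\in X: f(x)\leq\rho\}$ is $\tau$-compact for every $\rho\in\mathbb{R}$. A function on $Y$ is quasi-concave if all its superlevel sets $\{y\in Y: f(y)\geq\rho\}$, $\rho\in\mathbb{R}$, are convex. *)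

theory Defs
  imports "HOL-Analysis.Analysis"
begin

(* Real topological vector space; no separation axiom is required.  Continuity of scalar
   multiplication is stated by neighbourhood filters (as for addition in topological_monoid_add),
   and real_tvs_continuous_scaleR gives the usual form. *)
class real_tvs = real_vector + topological_ab_group_add +
  assumes tendsto_scaleR_Pair:
    "filterlim (\<lambda>p :: real \<times> 'a. fst p *\<^sub>R snd p) (nhds (c *\<^sub>R a)) (nhds c \<times>\<^sub>F nhds a)"

lemma real_tvs_continuous_scaleR:
  "continuous_on UNIV (\<lambda>p :: real \<times> 'a::real_tvs. fst p *\<^sub>R snd p)"
proof -
  have "((\<lambda>p. fst p *\<^sub>R snd p) \<longlongrightarrow> c *\<^sub>R a) (at (c, a))" for c and a :: 'a
    using tendsto_scaleR_Pair[of c a] unfolding nhds_prod[symmetric]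
    by (rule filterlim_mono) (simp_all add: at_within_def)
  then show ?thesis
    by (simp add: continuous_on_def)
qed

instance real_normed_vector < real_tvs
  by standard (intro tendsto_scaleR filterlim_fst filterlim_snd)

(* The dual space E* is the normed space of bounded linear functionals 'e \<Rightarrow>\<^sub>L real. *)
definition has_gateaux_derivative ::
  "('e::real_normed_vector \<Rightarrow> real) \<Rightarrow> ('e \<Rightarrow>\<^sub>L real) \<Rightarrow> 'e \<Rightarrow> bool" where
  "has_gateaux_derivative f \<phi> x \<longleftrightarrow>
     (\<forall>v. ((\<lambda>t. (f (x + t *\<^sub>R v) - f x) / t) \<longlongrightarrow> blinfun_apply \<phi> v) (at (0::real)))"

definition gateaux_differentiable ::
  "('e::real_normed_vector \<Rightarrow> real) \<Rightarrow> 'e \<Rightarrow> bool" where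
  "gateaux_differentiable f x \<longleftrightarrow> (\<exists>\<phi>. has_gateaux_derivative f \<phi> x)"

(* Meaningful only where f is Gateaux differentiable. *)
definition gateaux_deriv ::
  "('e::real_normed_vector \<Rightarrow> real) \<Rightarrow> 'e \<Rightarrow> ('e \<Rightarrow>\<^sub>L real)" where
  "gateaux_deriv f x = (THE \<phi>. has_gateaux_derivative f \<phi> x)"

lemma has_gateaux_derivative_unique:
  assumes "has_gateaux_derivative f \<phi> x" "has_gateaux_derivative f \<psi> x"
  shows "\<phi> = \<psi>"
proof (rule blinfun_eqI)
  fix v
  show "blinfun_apply \<phi> v = blinfun_apply \<psi> v"
    using assms unfolding has_gateaux_derivative_def
    by (meson tendsto_unique trivial_limit_at)
qed

lemma gateaux_deriv_eq:
  assumes "has_gateaux_derivative f \<phi> x"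
  shows "gateaux_deriv f x = \<phi>"
  unfolding gateaux_deriv_def
  using assms has_gateaux_derivative_unique by blast

(* Continuously Frechet differentiable on the whole space, the derivative being
   continuous as a map into the dual with its norm topology. *)
definition C1_functional :: "('e::real_normed_vector \<Rightarrow> real) \<Rightarrow> bool" where
  "C1_functional f \<longleftrightarrow>
     (\<exists>f' :: 'e \<Rightarrow> ('e \<Rightarrow>\<^sub>L real).
        (\<forall>x. (f has_derivative blinfun_apply (f' x)) (at x)) \<and> continuous_on UNIV f')"

definition lsc_in :: "'a topology \<Rightarrow> ('a \<Rightarrow> real) \<Rightarrow> bool" where
  "lsc_in T f \<longleftrightarrow> (\<forall>\<rho>. openin T {x \<in> topspace T. \<rho> < f x})"

definition inf_compact_in :: "'a topology \<Rightarrow> ('a \<Rightarrow> real) \<Rightarrow> bool" where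
  "inf_compact_in T f \<longleftrightarrow> (\<forall>\<rho>. compactin T {x \<in> topspace T. f x \<le> \<rho>})"

definition quasi_concave_on :: "'a::real_vector set \<Rightarrow> ('a \<Rightarrow> real) \<Rightarrow> bool" where
  "quasi_concave_on Y f \<longleftrightarrow> (\<forall>\<rho>. convex {y \<in> Y. f y \<ge> \<rho>})"

definition lsc_convex_gateaux :: "('e::real_normed_vector \<Rightarrow> real) \<Rightarrow> bool" where
  "lsc_convex_gateaux \<gamma> \<longleftrightarrow>
     lsc_in euclidean \<gamma> \<and> convex_on UNIV \<gamma> \<and> (\<forall>x. gateaux_differentiable \<gamma> x)"

(* Intended for \<Phi>, \<Psi> Gateaux differentiable at each point of X, and u0 in X. *)
definition pointwise_invariant ::
  "'e::real_normed_vector set \<Rightarrow> ('e \<Rightarrow> real) \<Rightarrow> ('e \<Rightarrow> real) \<Rightarrow> 'e \<Rightarrow> bool" where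
  "pointwise_invariant X \<Phi> \<Psi> u0 \<longleftrightarrow>
     (\<exists>v0\<in>X. \<exists>\<gamma>. lsc_convex_gateaux \<gamma> \<and>
        gateaux_deriv \<Phi> u0 + gateaux_deriv \<gamma> u0 = gateaux_deriv \<Psi> v0 + gateaux_deriv \<gamma> v0) \<or>
     (\<exists>v0\<in>X. \<exists>\<gamma>. lsc_convex_gateaux \<gamma> \<and> gateaux_deriv \<gamma> 0 = 0 \<and>
        gateaux_deriv \<Phi> u0 = gateaux_deriv \<Psi> v0 + gateaux_deriv \<gamma> (v0 - u0))"

end

theory Submission
  imports Defs
begin

text \<open>
  Put \<open>f x y = I x y - J x y + \<alpha> x + \<beta> x\<close>. The oscillation hypothesis turns the minimax gap of
  \<open>I - J\<close> into one for \<open>f\<close>, and continuity in \<open>y\<close> transfers it to \<open>S\<close>. Were all minimisers of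
  \<open>f(\<cdot>, y)\<close>, \<open>y \<in> S\<close>, unique, then on the (compact) convex hull of finitely many points of \<open>S\<close>
  a maximiser of \<open>y \<mapsto> min f(\<cdot>, y)\<close> together with its minimiser would be a saddle point,
  which by the finite intersection property closes the gap. Hence some \<open>f(\<cdot>, y)\<close> has two
  minimisers over \<open>X\<close>. The variational inequality at such a minimiser \<open>u\<close>, tested against the
  point \<open>v\<^sub>0\<close> of the invariance condition, forces equality in the monotonicity of the derivatives
  of the convex functions involved, so these derivatives agree at the two points and \<open>u\<close> is a
  critical point even if it lies on the boundary of \<open>X\<close>.
\<close>

section \<open>A strict minimax inequality forces two minimisers\<close>

lemma quasi_concave_on_subset:
  assumes "quasi_concave_on Y f" "convex S" "S \<subseteq> Y"
  shows "quasi_concave_on S f"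
  unfolding quasi_concave_on_def
proof
  fix \<rho>
  have "{y \<in> S. \<rho> \<le> f y} = S \<inter> {y \<in> Y. \<rho> \<le> f y}" using assms(3) by blast
  then show "convex {y \<in> S. \<rho> \<le> f y}"
    using assms(1,2) by (simp add: quasi_concave_on_def convex_Int)
qed

text \<open>The sublevel sets are closed by lower semicontinuity and one of them is compact, so the
  finite intersection property applies. The level \<open>r y\<close> may vary with \<open>y\<close>,
  which the existence of minimisers exploits.\<close>

lemma sublevel_fip:
  assumes "A \<noteq> {}"
    and lsc: "\<And>y. y \<in> A \<Longrightarrow> lsc_in T (f y)"
    and comp: "\<And>y. y \<in> A \<Longrightarrow> inf_compact_in T (f y)"
    and fin: "\<And>F. finite F \<Longrightarrow> F \<noteq> {} \<Longrightarrow> F \<subseteq> A \<Longrightarrow> \<exists>x\<in>topspace T. \<forall>y\<in>F. f y x \<le> r y"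
  shows "\<exists>x\<in>topspace T. \<forall>y\<in>A. f y x \<le> r y"
proof -
  define C where "C y = {x \<in> topspace T. f y x \<le> r y}" for y
  obtain a where a: "a \<in> A" using assms(1) by blast
  have compact: "compactin T (C a)"
    using comp[OF a] by (auto simp: inf_compact_in_def C_def)
  have closed: "closedin T (C y)" if "y \<in> A" for y
  proof -
    have "topspace T - C y = {x \<in> topspace T. r y < f y x}"
      by (auto simp: C_def)
    moreover have "openin T {x \<in> topspace T. r y < f y x}"
      using lsc[OF that] by (auto simp: lsc_in_def)
    ultimately show ?thesis
      by (auto simp: closedin_def C_def)
  qed
  have "C a \<inter> \<Inter>(C ` A) \<noteq> {}"
  proof -
    have "C a \<inter> \<Inter>\<F> \<noteq> {}" if "finite \<F>" "\<F> \<subseteq> C ` A" for \<F>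
    proof -
      obtain F where F: "finite F" "F \<subseteq> A" "\<F> = C ` F"
        using \<open>finite \<F>\<close> \<open>\<F> \<subseteq> C ` A\<close> finite_subset_image by metis
      show ?thesis
        using fin[of "insert a F"] F a by (auto simp: C_def)
    qed
    moreover have "\<forall>D\<in>C ` A. closedin T D" using closed by blast
    ultimately show ?thesis
      using compact unfolding compactin_fip by meson
  qed
  then obtain x where "x \<in> C a \<inter> \<Inter>(C ` A)" by blast
  then show ?thesis
    by (intro bexI[of _ x]) (auto simp: C_def)
qed

lemma lsc_inf_compact_attains_min:
  assumes "lsc_in T f" "inf_compact_in T f" "topspace T \<noteq> {}"
  shows "\<exists>x\<in>topspace T. \<forall>x'\<in>topspace T. f x \<le> f x'"
proof -
  \<comment> \<open>The index runs over the attained values themselves: the family is constantly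
    \<open>f\<close>, and the level equals the index.\<close>
  have "\<exists>x\<in>topspace T. \<forall>\<rho>\<in>f ` topspace T. f x \<le> \<rho>"
  proof (rule sublevel_fip)
    fix F assume F: "finite F" "F \<noteq> {}" "F \<subseteq> f ` topspace T"
    then have "Min F \<in> f ` topspace T" by (meson Min_in subset_iff)
    then obtain x where "x \<in> topspace T" "f x = Min F" by force
    then show "\<exists>x\<in>topspace T. \<forall>\<rho>\<in>F. f x \<le> \<rho>"
      using F by (intro bexI[of _ x]) simp_all
  qed (use assms in auto)
  then show ?thesis by blast
qed

text \<open>
  Let \<open>m = h x0 0\<close> and let \<open>t2\<close> be the last parameter at which \<open>x0\<close> is a minimiser with value \<open>m\<close>.
  A minimiser at a later parameter \<open>t\<close> exceeds \<open>m\<close> at \<open>t2\<close>, so by quasi-concavity it stays at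
  most \<open>m\<close> on \<open>{t..1}\<close>; by compactness, letting \<open>t\<close> decrease to \<open>t2\<close> yields a minimiser at \<open>t2\<close>
  with value at most \<open>m\<close> at \<open>1\<close>, which is not \<open>x0\<close>.
\<close>
lemma saddle_on_interval:
  fixes h :: "'a \<Rightarrow> real \<Rightarrow> real"
  assumes cont: "\<And>x. x \<in> topspace T \<Longrightarrow> continuous_on {0..1} (h x)"
    and qc: "\<And>x. x \<in> topspace T \<Longrightarrow> quasi_concave_on {0..1} (h x)"
    and lsc: "\<And>t. t \<in> {0..1} \<Longrightarrow> lsc_in T (\<lambda>x. h x t)"
    and comp: "\<And>t. t \<in> {0..1} \<Longrightarrow> inf_compact_in T (\<lambda>x. h x t)"
    and uniq: "\<And>t x1 x2. t \<in> {0..1} \<Longrightarrow> x1 \<in> topspace T \<Longrightarrow> x2 \<in> topspace T \<Longrightarrow>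
       \<forall>x\<in>topspace T. h x1 t \<le> h x t \<Longrightarrow> \<forall>x\<in>topspace T. h x2 t \<le> h x t \<Longrightarrow> x1 = x2"
    and x0: "x0 \<in> topspace T" "\<forall>x\<in>topspace T. h x0 0 \<le> h x 0"
    and max: "\<And>t. t \<in> {0..1} \<Longrightarrow> \<exists>x\<in>topspace T. h x t \<le> h x0 0"
  shows "h x0 1 \<le> h x0 0"
proof (rule ccontr)
  define m where "m = h x0 0"
  assume "\<not> h x0 1 \<le> h x0 0"
  then have m1: "m < h x0 1" by (simp add: m_def)
  have mid: "min (h x s) (h x u) \<le> h x t"
    if "x \<in> topspace T" "0 \<le> s" "s \<le> t" "t \<le> u" "u \<le> 1" for x s t u
  proof -
    let ?K = "{t \<in> {0..1}. h x t \<ge> min (h x s) (h x u)}"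
    have "convex ?K" using qc[OF that(1)] by (auto simp: quasi_concave_on_def)
    moreover have "s \<in> ?K" "u \<in> ?K" using that by auto
    ultimately have "closed_segment s u \<subseteq> ?K"
      by (simp add: closed_segment_subset)
    then have "t \<in> ?K" using that by (auto simp: closed_segment_eq_real_ivl subset_iff)
    then show ?thesis by simp
  qed
  \<comment> \<open>The parameters at which \<open>x0\<close> is a minimiser with value
    \<open>m\<close>, expressed by inequalities so that each condition cuts out a closed
    set.\<close>
  define P where "P = (\<Inter>x\<in>topspace T. {t \<in> {0..1}. m \<le> h x t}) \<inter> {t \<in> {0..1}. h x0 t \<le> m}"
  have "compact P"
  proof -
    have "closed {t \<in> {0..1}. m \<le> h x t}" if "x \<in> topspace T" for x
      using cont[OF that] continuous_on_closed_Collect_le[of "{0..1}" "\<lambda>_. m" "h x"] by simp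
    moreover have "closed {t \<in> {0..1}. h x0 t \<le> m}"
      using cont[OF x0(1)] continuous_on_closed_Collect_le[of "{0..1}" "h x0" "\<lambda>_. m"] by simp
    ultimately have "closed P" unfolding P_def by blast
    moreover have "P \<subseteq> {0..1}" by (auto simp: P_def)
    then have "bounded P" using bounded_closed_interval bounded_subset by blast
    ultimately show ?thesis by (simp add: compact_eq_bounded_closed)
  qed
  moreover have "0 \<in> P" using x0 by (auto simp: P_def m_def)
  ultimately obtain t2 where t2: "t2 \<in> P" and t2_max: "\<And>t. t \<in> P \<Longrightarrow> t \<le> t2"
    using compact_attains_sup[of P] by blast
  have ge: "m \<le> h x t2" if "x \<in> topspace T" for x
    using t2 that by (auto simp: P_def)
  have t2_01: "0 \<le> t2" "t2 \<le> 1" and eq: "h x0 t2 = m"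
    using t2 ge[OF x0(1)] by (auto simp: P_def)
  have "t2 < 1" using eq m1 t2_01 by (cases "t2 = 1") auto
  have eq_x0: "x = x0" if "x \<in> topspace T" "h x t2 \<le> m" for x
    using uniq[of t2 x x0] that x0(1) ge eq t2_01 by fastforce
  have later: "\<exists>x\<in>topspace T. \<forall>s\<in>{t..1}. h x s \<le> m" if t: "t2 < t" "t \<le> 1" for t
  proof -
    have t01: "t \<in> {0..1}" using t t2_01 by auto
    obtain x where x: "x \<in> topspace T" "\<forall>x'\<in>topspace T. h x t \<le> h x' t"
      using lsc_inf_compact_attains_min[OF lsc[OF t01] comp[OF t01]] x0(1) by blast
    have le: "h x t \<le> m" using max[OF t01] x(2) unfolding m_def by force
    have "m < h x t2"
    proof (rule ccontr)
      assume "\<not> m < h x t2"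
      then have [simp]: "x = x0" using eq_x0 x(1) by simp
      \<comment> \<open>\<open>h x0\<close> equals \<open>m\<close> at \<open>t2\<close> and exceeds
        it at \<open>1\<close>, so it cannot dip below \<open>m\<close> in between; hence
        \<open>t\<close> would lie in \<open>P\<close> beyond its maximum.\<close>
      have "m \<le> h x0 t" using mid[OF x0(1), of t2 t 1] t2_01 t eq m1 by auto
      then have "t \<in> P" using x le t01 by (auto simp: P_def)
      then show False using t2_max t by force
    qed
    \<comment> \<open>Values above \<open>m\<close> at both \<open>t2\<close> and \<open>s\<close>
      would force \<open>h x t\<close> above \<open>m\<close> as well.\<close>
    then have "h x s \<le> m" if "s \<in> {t..1}" for s
      using mid[OF x(1), of t2 t s] that t t2_01 le by (auto simp: min_def split: if_splits)
    then show ?thesis using x(1) by blast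
  qed
  have "\<exists>x\<in>topspace T. \<forall>s\<in>{t2<..1}. h x s \<le> m"
  \<comment> \<open>For finitely many parameters, the witness from \<open>later\<close> at the
    smallest of them serves all.\<close>
  proof (rule sublevel_fip[where f = "\<lambda>s x. h x s"])
    fix F :: "real set" assume F: "finite F" "F \<noteq> {}" "F \<subseteq> {t2<..1}"
    then have "Min F \<in> {t2<..1}" by (meson Min_in subset_iff)
    then obtain x where "x \<in> topspace T" "\<forall>s\<in>{Min F..1}. h x s \<le> m"
      using later by auto
    then show "\<exists>x\<in>topspace T. \<forall>s\<in>F. h x s \<le> m"
      using F by (intro bexI[of _ x]) auto
  qed (use \<open>t2 < 1\<close> t2_01 lsc comp in auto)
  then obtain x where x: "x \<in> topspace T" "\<And>s. s \<in> {t2<..1} \<Longrightarrow> h x s \<le> m" by blast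
  \<comment> \<open>The parameter \<open>t2\<close> is not in the index set; the bound reaches it by
    continuity.\<close>
  have "closure {t2<..1} = {t2..1}" using \<open>t2 < 1\<close> by simp
  moreover have "continuous_on {t2..1} (h x)"
    using cont[OF x(1)] by (rule continuous_on_subset) (use t2_01 in auto)
  ultimately have "h x t2 \<le> m"
    using continuous_le_on_closure[of "{t2<..1}" "h x" t2 m] x(2) t2_01 by auto
  then have "x = x0" using eq_x0 x(1) by simp
  then show False using x(2)[of 1] \<open>t2 < 1\<close> m1 by simp
qed

section \<open>Segments and finite hulls in a topological vector space\<close>

lemma continuous_on_scaleR_tvs:
  fixes g :: "'a::topological_space \<Rightarrow> 'b::real_tvs"
  assumes "continuous_on A c" "continuous_on A g"
  shows "continuous_on A (\<lambda>x. c x *\<^sub>R g x)"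
  using continuous_on_compose2[OF real_tvs_continuous_scaleR continuous_on_Pair[OF assms]]
  by simp

text \<open>Induction on the set: adding a point \<open>a\<close> turns the hull into a continuous
  image of the compact product of \<open>{0..1}\<close> with the old hull.\<close>

lemma compact_convex_hull_finite_tvs:
  fixes F :: "'b::real_tvs set"
  assumes "finite F"
  shows "compact (convex hull F)"
  using assms
proof (induction F)
  case (insert a F)
  show ?case
  proof (cases "F = {}")
    case False
    let ?g = "\<lambda>(u, b). u *\<^sub>R a + (1 - u) *\<^sub>R b"
    have "convex hull (insert a F) = ?g ` ({0..1} \<times> (convex hull F))"
    proof (intro equalityI subsetI)
      fix x assume "x \<in> convex hull (insert a F)"
      then obtain u v b where "u \<ge> 0" "v \<ge> 0" "u + v = 1" "b \<in> convex hull F"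
        "x = u *\<^sub>R a + v *\<^sub>R b"
        using convex_hull_insert[OF False] by blast
      moreover from this have "v = 1 - u" by simp
      ultimately show "x \<in> ?g ` ({0..1} \<times> (convex hull F))"
        by (intro image_eqI[of _ _ "(u, b)"]) auto
    next
      fix x assume "x \<in> ?g ` ({0..1} \<times> (convex hull F))"
      then obtain u b where "0 \<le> u" "u \<le> 1" "b \<in> convex hull F" "x = u *\<^sub>R a + (1 - u) *\<^sub>R b"
        by auto
      then show "x \<in> convex hull (insert a F)"
        unfolding convex_hull_insert[OF False]
        by (intro CollectI exI[of _ u] exI[of _ "1 - u"] exI[of _ b] conjI) simp_all
    qed
    moreover have "continuous_on ({0..1} \<times> (convex hull F)) ?g"
      unfolding case_prod_unfold
      by (intro continuous_on_add continuous_on_scaleR_tvs continuous_intros)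
    then have "compact (?g ` ({0..1} \<times> (convex hull F)))"
      using insert.IH by (intro compact_continuous_image compact_Times compact_Icc)
    ultimately show ?thesis by simp
  qed simp
qed simp

text \<open>Restriction to the segment from \<open>y0\<close> to \<open>y\<close>: composition with
  the affine path \<open>p\<close> preserves continuity and quasi-concavity, so the interval case
  applies.\<close>

lemma saddle_on_convex:
  fixes f :: "'a \<Rightarrow> 'b::real_tvs \<Rightarrow> real"
  assumes C: "convex C"
    and cont: "\<And>x. x \<in> topspace T \<Longrightarrow> continuous_on C (f x)"
    and qc: "\<And>x. x \<in> topspace T \<Longrightarrow> quasi_concave_on C (f x)"
    and lsc: "\<And>y. y \<in> C \<Longrightarrow> lsc_in T (\<lambda>x. f x y)"
    and comp: "\<And>y. y \<in> C \<Longrightarrow> inf_compact_in T (\<lambda>x. f x y)"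
    and uniq: "\<And>y x1 x2. y \<in> C \<Longrightarrow> x1 \<in> topspace T \<Longrightarrow> x2 \<in> topspace T \<Longrightarrow>
       \<forall>x\<in>topspace T. f x1 y \<le> f x y \<Longrightarrow> \<forall>x\<in>topspace T. f x2 y \<le> f x y \<Longrightarrow> x1 = x2"
    and x0: "x0 \<in> topspace T" "\<forall>x\<in>topspace T. f x0 y0 \<le> f x y0"
    and max: "\<And>y. y \<in> C \<Longrightarrow> \<exists>x\<in>topspace T. f x y \<le> f x0 y0"
    and y: "y0 \<in> C" "y \<in> C"
  shows "f x0 y \<le> f x0 y0"
proof -
  define p where "p t = (1 - t) *\<^sub>R y0 + t *\<^sub>R y" for t :: real
  have p01: "p t \<in> C" if "t \<in> {0..1}" for t
    using C y that by (auto simp: p_def convex_alt)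
  have p_cont: "continuous_on {0..1} p"
    unfolding p_def by (intro continuous_on_add continuous_on_scaleR_tvs continuous_intros)
  have p_comb: "p (u * s + v * t) = u *\<^sub>R p s + v *\<^sub>R p t" if "u + v = 1" for u v s t
  proof -
    \<comment> \<open>Keeping \<open>u + v\<close> in place of 1 makes this a purely algebraic
      identity.\<close>
    have "u *\<^sub>R p s + v *\<^sub>R p t = (u + v - (u * s + v * t)) *\<^sub>R y0 + (u * s + v * t) *\<^sub>R y"
      by (simp add: p_def algebra_simps)
    then show ?thesis using that by (simp add: p_def)
  qed
  have "f x0 (p 1) \<le> f x0 (p 0)"
  proof (rule saddle_on_interval[where h = "\<lambda>x t. f x (p t)" and T = T])
    fix x assume x: "x \<in> topspace T"
    show "continuous_on {0..1} (\<lambda>t. f x (p t))"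
      using continuous_on_compose2[OF cont[OF x] p_cont] p01 by blast
    show "quasi_concave_on {0..1} (\<lambda>t. f x (p t))"
      unfolding quasi_concave_on_def
    proof (intro allI convexI)
      fix \<rho> s t u v :: real
      assume st: "s \<in> {t \<in> {0..1}. \<rho> \<le> f x (p t)}" "t \<in> {t \<in> {0..1}. \<rho> \<le> f x (p t)}"
        and uv: "0 \<le> u" "0 \<le> v" "u + v = 1"
      have "convex {y \<in> C. \<rho> \<le> f x y}"
        using qc[OF x] by (simp add: quasi_concave_on_def)
      moreover have "p s \<in> {y \<in> C. \<rho> \<le> f x y}" "p t \<in> {y \<in> C. \<rho> \<le> f x y}"
        using st p01 by auto
      ultimately have "u *\<^sub>R p s + v *\<^sub>R p t \<in> {y \<in> C. \<rho> \<le> f x y}"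
        using uv by (auto dest: convexD)
      moreover have "u *\<^sub>R s + v *\<^sub>R t \<in> {0..1}"
        using st uv by (intro convexD) auto
      ultimately show "u *\<^sub>R s + v *\<^sub>R t \<in> {t \<in> {0..1}. \<rho> \<le> f x (p t)}"
        using p_comb[OF uv(3), of s t] by simp
    qed
  next
    show "\<forall>x\<in>topspace T. f x0 (p 0) \<le> f x (p 0)" using x0 by (simp add: p_def)
  next
    fix t :: real assume "t \<in> {0..1}"
    from max[OF p01[OF this]] show "\<exists>x\<in>topspace T. f x (p t) \<le> f x0 (p 0)"
      by (simp add: p_def)
  next
    fix t x1 x2
    assume "t \<in> {0..1::real}" "x1 \<in> topspace T" "x2 \<in> topspace T"
      "\<forall>x\<in>topspace T. f x1 (p t) \<le> f x (p t)" "\<forall>x\<in>topspace T. f x2 (p t) \<le> f x (p t)"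
    then show "x1 = x2" using uniq p01 by blast
  qed (use p01 lsc comp x0 in auto)
  then show ?thesis by (simp add: p_def)
qed

text \<open>The minimal value is a pointwise infimum of continuous functions of \<open>y\<close>,
  hence upper semicontinuous, and so attains its maximum on a compact set; the proof is a direct
  covering argument.\<close>

lemma min_value_attains_max:
  fixes f :: "'a \<Rightarrow> 'b::topological_space \<Rightarrow> real"
  assumes C: "compact C" "C \<noteq> {}"
    and cont: "\<And>x. x \<in> A \<Longrightarrow> continuous_on C (f x)"
    and g: "\<And>y. y \<in> C \<Longrightarrow> g y \<in> A" "\<And>x y. y \<in> C \<Longrightarrow> x \<in> A \<Longrightarrow> f (g y) y \<le> f x y"
  shows "\<exists>y0\<in>C. \<forall>y\<in>C. f (g y) y \<le> f (g y0) y0"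
proof (rule ccontr)
  assume neg: "\<not> ?thesis"
  \<comment> \<open>The points of \<open>C\<close> whose minimal value lies strictly below that of
    \<open>z\<close>. Without a maximiser, these relatively open sets cover
    \<open>C\<close>.\<close>
  define U where "U z = (\<Union>x\<in>A. {y \<in> C. f x y < f (g z) z})" for z
  have "openin (top_of_set C) (U z)" for z
    unfolding U_def
  proof (intro openin_Union, clarify)
    fix x assume "x \<in> A"
    have "openin (top_of_set C) (C \<inter> f x -` {..<f (g z) z})"
      using cont[OF \<open>x \<in> A\<close>] open_lessThan by (rule continuous_openin_preimage_gen)
    moreover have "C \<inter> f x -` {..<f (g z) z} = {y \<in> C. f x y < f (g z) z}" by auto
    ultimately show "openin (top_of_set C) {y \<in> C. f x y < f (g z) z}" by simp
  qed
  moreover have "C \<subseteq> \<Union>(U ` C)"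
    using neg g(1) by (fastforce simp: U_def not_le)
  ultimately obtain D where "D \<subseteq> U ` C" "finite D" "C \<subseteq> \<Union>D"
    using C(1) unfolding compact_eq_openin_cover by (metis (no_types, lifting) imageE)
  then obtain B where B: "B \<subseteq> C" "finite B" "C \<subseteq> \<Union>(U ` B)"
    by (metis finite_subset_image)
  then have "B \<noteq> {}" using C(2) by auto
  define \<phi> where "\<phi> z = f (g z) z" for z
  have "Max (\<phi> ` B) \<in> \<phi> ` B" using B(2) \<open>B \<noteq> {}\<close> by simp
  then obtain z where "z \<in> B" "Max (\<phi> ` B) = \<phi> z" by blast
  then have z: "z \<in> B" "\<And>z'. z' \<in> B \<Longrightarrow> f (g z') z' \<le> f (g z) z"
    using B(2) by (simp_all add: \<phi>_def flip: \<open>Max (\<phi> ` B) = \<phi> z\<close>[unfolded \<phi>_def])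
  \<comment> \<open>\<open>z\<close> has the largest minimal value in the finite set
    \<open>B\<close>, yet it lies in some \<open>U z'\<close> of the subcover.\<close>
  then obtain z' x where "z' \<in> B" "x \<in> A" "f x z < f (g z') z'"
    using B by (auto simp: U_def subset_iff)
  then show False using z g(2)[of z x] B(1) by force
qed

text \<open>The number \<open>r\<close> is a level in the minimax gap. If minimisers were unique,
  the minimiser at a saddle point over a finite hull would stay at or below \<open>r\<close> on
  finitely many points chosen to make that impossible.\<close>

theorem exists_two_minimisers:
  fixes f :: "'a \<Rightarrow> 'b::real_tvs \<Rightarrow> real"
  assumes S: "convex S"
    and cont: "\<And>x. x \<in> topspace T \<Longrightarrow> continuous_on S (f x)"
    and qc: "\<And>x. x \<in> topspace T \<Longrightarrow> quasi_concave_on S (f x)"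
    and lsc: "\<And>y. y \<in> S \<Longrightarrow> lsc_in T (\<lambda>x. f x y)"
    and comp: "\<And>y. y \<in> S \<Longrightarrow> inf_compact_in T (\<lambda>x. f x y)"
    and nonempty: "topspace T \<noteq> {}"
    and below: "\<And>y. y \<in> S \<Longrightarrow> \<exists>x\<in>topspace T. f x y \<le> r"
    and above: "\<And>x. x \<in> topspace T \<Longrightarrow> \<exists>y\<in>S. r < f x y"
  shows "\<exists>y\<in>S. \<exists>x1\<in>topspace T. \<exists>x2\<in>topspace T. x1 \<noteq> x2 \<and>
    (\<forall>x\<in>topspace T. f x1 y \<le> f x y \<and> f x2 y \<le> f x y)"
proof (rule ccontr)
  assume neg: "\<not> ?thesis"
  have uniq: "x1 = x2"
    if "y \<in> S" "x1 \<in> topspace T" "x2 \<in> topspace T"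
      "\<forall>x\<in>topspace T. f x1 y \<le> f x y" "\<forall>x\<in>topspace T. f x2 y \<le> f x y" for y x1 x2
    using neg that by blast
  have "S \<noteq> {}" using above nonempty by blast
  \<comment> \<open>The sublevel sets at level \<open>r\<close> have no common point, so already
    finitely many of them have none.\<close>
  have "\<not> (\<exists>x\<in>topspace T. \<forall>y\<in>S. f x y \<le> r)" using above by force
  then obtain F where F: "finite F" "F \<noteq> {}" "F \<subseteq> S"
    and no_common: "\<not> (\<exists>x\<in>topspace T. \<forall>y\<in>F. f x y \<le> r)"
    using sublevel_fip[of S T "\<lambda>y x. f x y" "\<lambda>_. r"] \<open>S \<noteq> {}\<close> lsc comp by blast
  define C where "C = convex hull F"
  have C: "compact C" "C \<noteq> {}" "convex C" "F \<subseteq> C" "C \<subseteq> S"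
    using F S by (simp_all add: C_def compact_convex_hull_finite_tvs hull_minimal hull_subset)
  have "\<forall>y\<in>C. \<exists>x\<in>topspace T. \<forall>x'\<in>topspace T. f x y \<le> f x' y"
    using lsc_inf_compact_attains_min lsc comp nonempty C(5) by blast
  then obtain g where g: "\<And>y. y \<in> C \<Longrightarrow> g y \<in> topspace T"
    "\<And>x y. y \<in> C \<Longrightarrow> x \<in> topspace T \<Longrightarrow> f (g y) y \<le> f x y"
    by metis
  have cont_C: "continuous_on C (f x)" if "x \<in> topspace T" for x
    using cont[OF that] C(5) by (rule continuous_on_subset)
  have qc_C: "quasi_concave_on C (f x)" if "x \<in> topspace T" for x
    using quasi_concave_on_subset[OF qc[OF that] C(3,5)] .
  \<comment> \<open>The candidate saddle point is \<open>y0\<close> together with its minimiser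
    \<open>g y0\<close>.\<close>
  obtain y0 where y0: "y0 \<in> C" and y0_max: "\<And>y. y \<in> C \<Longrightarrow> f (g y) y \<le> f (g y0) y0"
    using min_value_attains_max[OF C(1,2) cont_C g] by blast
  have "f (g y0) y \<le> f (g y0) y0" if "y \<in> C" for y
  proof (rule saddle_on_convex[OF C(3) cont_C qc_C])
    show "\<exists>x\<in>topspace T. f x y \<le> f (g y0) y0" if "y \<in> C" for y
      using y0_max g(1) that by blast
    show "x1 = x2"
      if "y \<in> C" "x1 \<in> topspace T" "x2 \<in> topspace T"
      "\<forall>x\<in>topspace T. f x1 y \<le> f x y" "\<forall>x\<in>topspace T. f x2 y \<le> f x y" for y x1 x2
      using uniq that C(5) by blast
  qed (use y0 g lsc comp C(5) that in auto)
  moreover have "f (g y0) y0 \<le> r"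
    using below[of y0] g(2)[OF y0] y0 C(5) by force
  ultimately show False
    using no_common C(4) g(1)[OF y0] by fastforce
qed

section \<open>Pointwise invariance and critical points\<close>

lemma has_gateaux_derivativeD_at_right:
  assumes "has_gateaux_derivative f D x"
  shows "((\<lambda>t. (f (x + t *\<^sub>R v) - f x) / t) \<longlongrightarrow> blinfun_apply D v) (at_right 0)"
  using assms unfolding has_gateaux_derivative_def by (blast intro: tendsto_within_subset)

lemma has_gateaux_derivative_add:
  assumes "has_gateaux_derivative f D x" "has_gateaux_derivative g D' x"
  shows "has_gateaux_derivative (\<lambda>x. f x + g x) (D + D') x"
  unfolding has_gateaux_derivative_def
proof
  fix v
  have "((\<lambda>t. (f (x + t *\<^sub>R v) - f x) / t + (g (x + t *\<^sub>R v) - g x) / t)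
      \<longlongrightarrow> blinfun_apply D v + blinfun_apply D' v) (at 0)"
    using assms unfolding has_gateaux_derivative_def by (intro tendsto_add) auto
  then show "((\<lambda>t. (f (x + t *\<^sub>R v) + g (x + t *\<^sub>R v) - (f x + g x)) / t)
      \<longlongrightarrow> blinfun_apply (D + D') v) (at 0)"
    by (simp add: blinfun.add_left add_divide_distrib diff_divide_distrib algebra_simps)
qed

lemma has_gateaux_derivative_minus:
  assumes "has_gateaux_derivative f D x"
  shows "has_gateaux_derivative (\<lambda>x. - f x) (- D) x"
  unfolding has_gateaux_derivative_def
proof
  fix v
  have "((\<lambda>t. - ((f (x + t *\<^sub>R v) - f x) / t)) \<longlongrightarrow> - blinfun_apply D v) (at 0)"
    using assms unfolding has_gateaux_derivative_def by (intro tendsto_minus) auto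
  then show "((\<lambda>t. (- f (x + t *\<^sub>R v) - (- f x)) / t) \<longlongrightarrow> blinfun_apply (- D) v) (at 0)"
    by (simp add: blinfun.minus_left minus_divide_left diff_divide_distrib algebra_simps)
qed

lemma has_gateaux_derivative_diff:
  assumes "has_gateaux_derivative f D x" "has_gateaux_derivative g D' x"
  shows "has_gateaux_derivative (\<lambda>x. f x - g x) (D - D') x"
  using has_gateaux_derivative_add[OF assms(1) has_gateaux_derivative_minus[OF assms(2)]] by simp

lemma has_gateaux_derivative_gateaux_deriv:
  "gateaux_differentiable f x \<Longrightarrow> has_gateaux_derivative f (gateaux_deriv f x) x"
  unfolding gateaux_differentiable_def using gateaux_deriv_eq by blast

lemma C1_functional_imp_gateaux_differentiable:
  assumes "C1_functional f"
  shows "gateaux_differentiable f x"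
proof -
  obtain f' where f': "\<And>x. (f has_derivative blinfun_apply (f' x)) (at x)"
    using assms unfolding C1_functional_def by blast
  have "((\<lambda>t. (f (x + t *\<^sub>R v) - f x) / t) \<longlongrightarrow> blinfun_apply (f' x) v) (at 0)" for v
  proof -
    have "((\<lambda>t. x + t *\<^sub>R v) has_derivative (\<lambda>t. t *\<^sub>R v)) (at 0)"
      by (auto intro!: derivative_eq_intros)
    moreover have "(f has_derivative blinfun_apply (f' x)) (at (x + 0 *\<^sub>R v))"
      using f' by simp
    ultimately have "((\<lambda>t. f (x + t *\<^sub>R v)) has_derivative (\<lambda>t. blinfun_apply (f' x) (t *\<^sub>R v))) (at 0)"
      by (rule has_derivative_compose)
    then have "((\<lambda>t. f (x + t *\<^sub>R v)) has_field_derivative blinfun_apply (f' x) v) (at 0)"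
      by (simp add: has_field_derivative_def blinfun.scaleR_right mult_commute_abs)
    then show ?thesis by (simp add: has_field_derivative_iff)
  qed
  then show ?thesis
    unfolding gateaux_differentiable_def has_gateaux_derivative_def by blast
qed

section \<open>First-order conditions for minimisers and convex functions\<close>

lemma gateaux_derivative_nonneg_at_min:
  assumes "has_gateaux_derivative f D u" "convex X" "u \<in> X" "v \<in> X"
    and min: "\<And>x. x \<in> X \<Longrightarrow> f u \<le> f x"
  shows "0 \<le> blinfun_apply D (v - u)"
\<comment> \<open>The limit is taken from the right because \<open>u\<close> may lie on the boundary
  of \<open>X\<close>, where only the direction towards \<open>v\<close> is known to stay
  inside.\<close>
proof (rule tendsto_lowerbound[OF has_gateaux_derivativeD_at_right[OF assms(1)]])
  have "0 \<le> (f (u + t *\<^sub>R (v - u)) - f u) / t" if "0 < t" "t < 1" for t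
  proof -
    have "(1 - t) *\<^sub>R u + t *\<^sub>R v \<in> X"
      using assms(2-4) that by (simp add: convex_alt)
    then have "u + t *\<^sub>R (v - u) \<in> X" by (simp add: algebra_simps)
    then show ?thesis using min that by simp
  qed
  then show "\<forall>\<^sub>F t in at_right 0. 0 \<le> (f (u + t *\<^sub>R (v - u)) - f u) / t"
    unfolding eventually_at_right_field by (intro exI[of _ 1]) simp
qed simp

text \<open>Convexity bounds the difference quotient along the segment by its value at
  \<open>t = 1\<close>; then \<open>t\<close> tends to 0 from the right.\<close>

lemma convex_on_gateaux_subgradient:
  assumes "convex_on UNIV f" "has_gateaux_derivative f D u"
  shows "f u + blinfun_apply D (z - u) \<le> f z"
proof -
  have "blinfun_apply D (z - u) \<le> f z - f u"
  proof (rule tendsto_upperbound[OF has_gateaux_derivativeD_at_right[OF assms(2)]])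
    have "(f (u + t *\<^sub>R (z - u)) - f u) / t \<le> f z - f u" if "0 < t" "t < 1" for t
    proof -
      have "f ((1 - t) *\<^sub>R u + t *\<^sub>R z) \<le> (1 - t) * f u + t * f z"
        using convex_onD[OF assms(1), of t u z] that by simp
      moreover have "(1 - t) *\<^sub>R u + t *\<^sub>R z = u + t *\<^sub>R (z - u)" by (simp add: algebra_simps)
      ultimately have "f (u + t *\<^sub>R (z - u)) - f u \<le> t * (f z - f u)"
        by (simp add: algebra_simps)
      then show ?thesis using that by (simp add: pos_divide_le_eq mult.commute)
    qed
    then show "\<forall>\<^sub>F t in at_right 0. (f (u + t *\<^sub>R (z - u)) - f u) / t \<le> f z - f u"
      unfolding eventually_at_right_field by (intro exI[of _ 1]) simp
  qed simp
  then show ?thesis by simp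
qed

text \<open>A subgradient lies below the derivative in every direction; using \<open>w\<close> and
  \<open>- w\<close> gives equality.\<close>

lemma subgradient_eq_gateaux_derivative:
  assumes "has_gateaux_derivative f D v" "\<And>z. f v + blinfun_apply D' (z - v) \<le> f z"
  shows "D' = D"
proof -
  have D'_le: "blinfun_apply D' w \<le> blinfun_apply D w" for w
  proof (rule tendsto_lowerbound[OF has_gateaux_derivativeD_at_right[OF assms(1)]])
    have "blinfun_apply D' w \<le> (f (v + t *\<^sub>R w) - f v) / t" if "0 < t" for t
      using assms(2)[of "v + t *\<^sub>R w"] that
      by (simp add: blinfun.scaleR_right le_divide_eq mult.commute)
    then show "\<forall>\<^sub>F t in at_right 0. blinfun_apply D' w \<le> (f (v + t *\<^sub>R w) - f v) / t"
      unfolding eventually_at_right_field by (intro exI[of _ 1]) simp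
  qed simp
  show ?thesis
    using D'_le D'_le[of "- w" for w] by (intro blinfun_eqI antisym) (auto simp: blinfun.minus_right)
qed

text \<open>The sum of the subgradient inequalities at \<open>u\<close> and at
  \<open>v\<close>.\<close>

lemma convex_on_gateaux_monotone:
  assumes "convex_on UNIV f" "has_gateaux_derivative f D u" "has_gateaux_derivative f D' v"
  shows "blinfun_apply D (v - u) \<le> blinfun_apply D' (v - u)"
  using convex_on_gateaux_subgradient[OF assms(1,2), of v]
    convex_on_gateaux_subgradient[OF assms(1,3), of u] blinfun.minus_right[of D' "v - u"]
  by simp

text \<open>Under equality, the supporting affine function of \<open>f\<close> at \<open>u\<close>
  also touches \<open>f\<close> at \<open>v\<close>. Thus \<open>D\<close> is a subgradient at
  \<open>v\<close>, where the only one is \<open>D'\<close>.\<close>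

lemma convex_on_gateaux_monotone_eq:
  assumes "convex_on UNIV f" "has_gateaux_derivative f D u" "has_gateaux_derivative f D' v"
    and "blinfun_apply D (v - u) = blinfun_apply D' (v - u)"
  shows "D = D'"
proof (rule subgradient_eq_gateaux_derivative[OF assms(3)])
  fix z
  have "f v \<le> f u + blinfun_apply D (v - u)"
    using convex_on_gateaux_subgradient[OF assms(1,3), of u] assms(4)
      blinfun.minus_right[of D' "v - u"] by simp
  moreover have "blinfun_apply D (z - u) = blinfun_apply D (v - u) + blinfun_apply D (z - v)"
    by (simp flip: blinfun.add_right)
  ultimately show "f v + blinfun_apply D (z - v) \<le> f z"
    using convex_on_gateaux_subgradient[OF assms(1,2), of z] by simp
qed

text \<open>Minimality bounds the derivative of \<Phi> at \<open>u\<close> by that of \<Psi> at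
  \<open>u\<close> along \<open>v - u\<close>, and monotonicity bounds the latter by that of \<Psi>
  at \<open>v\<close>. The invariance identity, paired with \<open>v - u\<close>, leaves no slack in
  these bounds or in monotonicity for \<gamma>, so the derivatives of \<Psi> and of \<gamma>
  coincide at the points compared.\<close>

lemma pointwise_invariant_minimiser_critical:
  assumes "convex X" "u \<in> X"
    and \<Phi>: "gateaux_differentiable \<Phi> u"
    and \<Psi>: "\<And>x. x \<in> X \<Longrightarrow> gateaux_differentiable \<Psi> x" "convex_on UNIV \<Psi>"
    and min: "\<And>x. x \<in> X \<Longrightarrow> \<Psi> u - \<Phi> u \<le> \<Psi> x - \<Phi> x"
    and inv: "pointwise_invariant X \<Phi> \<Psi> u"
  shows "gateaux_deriv \<Phi> u = gateaux_deriv \<Psi> u"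
proof -
  note has = has_gateaux_derivative_gateaux_deriv
  have vi: "blinfun_apply (gateaux_deriv \<Phi> u) (v - u) \<le> blinfun_apply (gateaux_deriv \<Psi> u) (v - u)"
    if "v \<in> X" for v
    using gateaux_derivative_nonneg_at_min[OF has_gateaux_derivative_diff[OF has[OF \<Psi>(1)] has[OF \<Phi>]]
        assms(1,2) that min] assms(2) by (simp add: blinfun.diff_left)
  note mono = convex_on_gateaux_monotone[OF \<Psi>(2) has[OF \<Psi>(1)] has[OF \<Psi>(1)]]
  note mono_eq = convex_on_gateaux_monotone_eq[OF \<Psi>(2) has[OF \<Psi>(1)] has[OF \<Psi>(1)]]
  from inv show ?thesis
    unfolding pointwise_invariant_def
  proof (elim disjE bexE exE conjE)
    fix v \<gamma>
    assume v: "v \<in> X" and \<gamma>: "lsc_convex_gateaux \<gamma>"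
      and eq: "gateaux_deriv \<Phi> u + gateaux_deriv \<gamma> u = gateaux_deriv \<Psi> v + gateaux_deriv \<gamma> v"
    have \<gamma>: "convex_on UNIV \<gamma>" "\<And>x. has_gateaux_derivative \<gamma> (gateaux_deriv \<gamma> x) x"
      using \<gamma> by (auto simp: lsc_convex_gateaux_def has)
    note \<gamma>_mono = convex_on_gateaux_monotone[OF \<gamma>(1) \<gamma>(2)[of u] \<gamma>(2)[of v]]
    note \<gamma>_eq = convex_on_gateaux_monotone_eq[OF \<gamma>(1) \<gamma>(2)[of u] \<gamma>(2)[of v]]
    have "blinfun_apply (gateaux_deriv \<Phi> u) (v - u) + blinfun_apply (gateaux_deriv \<gamma> u) (v - u)
      = blinfun_apply (gateaux_deriv \<Psi> v) (v - u) + blinfun_apply (gateaux_deriv \<gamma> v) (v - u)"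
      using eq by (simp flip: blinfun.add_left)
    with vi[OF v] mono[OF \<open>u \<in> X\<close> v] \<gamma>_mono
    have "gateaux_deriv \<Psi> u = gateaux_deriv \<Psi> v" "gateaux_deriv \<gamma> u = gateaux_deriv \<gamma> v"
      by (intro mono_eq[OF \<open>u \<in> X\<close> v] \<gamma>_eq; linarith)+
    with eq show ?thesis by simp
  next
    fix v \<gamma>
    assume v: "v \<in> X" and \<gamma>: "lsc_convex_gateaux \<gamma>" and \<gamma>0: "gateaux_deriv \<gamma> 0 = 0"
      and eq: "gateaux_deriv \<Phi> u = gateaux_deriv \<Psi> v + gateaux_deriv \<gamma> (v - u)"
    have \<gamma>: "convex_on UNIV \<gamma>" "\<And>x. has_gateaux_derivative \<gamma> (gateaux_deriv \<gamma> x) x"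
      using \<gamma> by (auto simp: lsc_convex_gateaux_def has)
    \<comment> \<open>Here \<gamma> is compared at 0 and \<open>v - u\<close>, whose difference is
      again the direction \<open>v - u\<close>.\<close>
    note \<gamma>_mono = convex_on_gateaux_monotone[OF \<gamma>(1) \<gamma>(2)[of 0] \<gamma>(2)[of "v - u"], simplified]
    note \<gamma>_eq = convex_on_gateaux_monotone_eq[OF \<gamma>(1) \<gamma>(2)[of 0] \<gamma>(2)[of "v - u"], simplified]
    have "blinfun_apply (gateaux_deriv \<Phi> u) (v - u)
      = blinfun_apply (gateaux_deriv \<Psi> v) (v - u) + blinfun_apply (gateaux_deriv \<gamma> (v - u)) (v - u)"
      using eq by (simp add: blinfun.add_left)
    with vi[OF v] mono[OF \<open>u \<in> X\<close> v] \<gamma>_mono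
    have "gateaux_deriv \<Psi> u = gateaux_deriv \<Psi> v" "gateaux_deriv \<gamma> 0 = gateaux_deriv \<gamma> (v - u)"
      using \<gamma>0 by (intro mono_eq[OF \<open>u \<in> X\<close> v] \<gamma>_eq; simp)+
    with eq \<gamma>0 show ?thesis by simp
  qed
qed

section \<open>From the oscillation bound to a gap\<close>

text \<open>Adding \<open>h\<close> raises the sup-inf by at most the supremum of \<open>h\<close>
  and keeps the inf-sup at least its old value plus the infimum of \<open>h\<close>. The oscillation
  bound leaves room for \<open>r\<close> between the two.\<close>

lemma minimax_gap_add:
  fixes g :: "'a \<Rightarrow> 'b \<Rightarrow> real" and h :: "'a \<Rightarrow> real"
  assumes "X \<noteq> {}"
    and osc: "(SUP x\<in>X. ereal (h x)) - (INF x\<in>X. ereal (h x))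
      < (INF x\<in>X. SUP y\<in>Y. ereal (g x y)) - (SUP y\<in>Y. INF x\<in>X. ereal (g x y))"
    and gap: "(SUP y\<in>Y. INF x\<in>X. ereal (g x y)) < (INF x\<in>X. SUP y\<in>Y. ereal (g x y))"
  shows "\<exists>r. (\<forall>y\<in>Y. \<exists>x\<in>X. g x y + h x < r) \<and> (\<forall>x\<in>X. \<exists>y\<in>Y. r < g x y + h x)"
proof -
  define A B P Q where "A = (SUP x\<in>X. ereal (h x))" and "B = (INF x\<in>X. ereal (h x))"
    and "P = (INF x\<in>X. SUP y\<in>Y. ereal (g x y))" and "Q = (SUP y\<in>Y. INF x\<in>X. ereal (g x y))"
  have hAB: "B \<le> ereal (h x)" "ereal (h x) \<le> A" if "x \<in> X" for x
    using that by (auto simp: A_def B_def intro: SUP_upper INF_lower)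
  have lt: "A - B < P - Q" "Q < P"
    using osc gap by (simp_all add: A_def B_def P_def Q_def)
  obtain x0 where "x0 \<in> X" using \<open>X \<noteq> {}\<close> by blast
  \<comment> \<open>An infinite \<open>A\<close> or \<open>B\<close> would make \<open>A - B\<close>
    infinite, against the strict bound.\<close>
  from hAB[OF this] lt(1) obtain a b where ab: "A = ereal a" "B = ereal b"
    by (cases A; cases B) auto
  \<comment> \<open>\<open>Q < P\<close> excludes equal infinities, whose difference is infinite in
    \<open>ereal\<close>.\<close>
  have "Q + ereal a < P + ereal b"
    using lt unfolding ab by (cases P; cases Q) auto
  then obtain r where r: "Q + ereal a < ereal r" "ereal r < P + ereal b"
    using ereal_dense2 by blast
  have "\<exists>x\<in>X. g x y + h x < r" if "y \<in> Y" for y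
  proof -
    have "(INF x\<in>X. ereal (g x y)) \<le> Q" unfolding Q_def using that by (rule SUP_upper)
    also have "Q < ereal (r - a)" using r(1) by (cases Q) auto
    finally obtain x where "x \<in> X" "g x y < r - a" by (auto simp: INF_less_iff)
    then show ?thesis using hAB(2)[of x] ab by (intro bexI[of _ x]) auto
  qed
  moreover have "\<exists>y\<in>Y. r < g x y + h x" if "x \<in> X" for x
  proof -
    have "ereal (r - b) < P" using r(2) by (cases P) auto
    also have "P \<le> (SUP y\<in>Y. ereal (g x y))" unfolding P_def using that by (rule INF_lower)
    finally obtain y where "y \<in> Y" "r - b < g x y" by (auto simp: less_SUP_iff)
    then show ?thesis using hAB(1)[OF that] ab by (intro bexI[of _ y]) auto
  qed
  ultimately show ?thesis by blast
qed

text \<open>The strict superlevel set is relatively open in \<open>Y\<close>, so it meets the dense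
  set \<open>S\<close>. This moves the lower side of the gap from \<open>Y\<close> to
  \<open>S\<close>.\<close>

lemma continuous_on_less_dense:
  fixes f :: "'b::topological_space \<Rightarrow> real"
  assumes "continuous_on Y f" "S \<subseteq> Y" "Y \<subseteq> closure S" "y \<in> Y" "r < f y"
  shows "\<exists>s\<in>S. r < f s"
proof -
  obtain U where U: "open U" "U \<inter> Y = f -` {r<..} \<inter> Y"
    using assms(1) unfolding continuous_on_open_invariant by (metis open_greaterThan)
  then have "U \<inter> closure S \<noteq> {}" using assms(3-5) by auto
  then have "U \<inter> S \<noteq> {}" using U(1) open_Int_closure_eq_empty by blast
  then show ?thesis using U(2) assms(2) by auto
qed

theorem theorem1p1:
  fixes X :: "'e::banach set"
    and Y :: "'f::real_tvs set"
    and I J :: "'e \<Rightarrow> 'f \<Rightarrow> real"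
    and \<alpha> \<beta> :: "'e \<Rightarrow> real"
  assumes X: "closed X" "convex X" "X \<noteq> {}"
    and Y: "convex Y"
    and \<alpha>_diff: "\<And>x. x \<in> X \<Longrightarrow> gateaux_differentiable \<alpha> x"
    and I_diff: "\<And>x y. x \<in> X \<Longrightarrow> y \<in> Y \<Longrightarrow> gateaux_differentiable (\<lambda>x. I x y) x"
    and \<beta>_C1: "C1_functional \<beta>"
    and J_C1: "\<And>y. y \<in> Y \<Longrightarrow> C1_functional (\<lambda>x. J x y)"
    and gap: "(SUP y\<in>Y. INF x\<in>X. ereal (I x y - J x y))
                < (INF x\<in>X. SUP y\<in>Y. ereal (I x y - J x y))"
    and osc: "(SUP x\<in>X. ereal (\<alpha> x + \<beta> x)) - (INF x\<in>X. ereal (\<alpha> x + \<beta> x))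
                < (INF x\<in>X. SUP y\<in>Y. ereal (I x y - J x y))
                  - (SUP y\<in>Y. INF x\<in>X. ereal (I x y - J x y))"
    and i1: "\<And>y. y \<in> Y \<Longrightarrow> lsc_in euclidean (\<lambda>x. I x y + \<alpha> x) \<and>
                              convex_on UNIV (\<lambda>x. I x y + \<alpha> x)"
    and i2: "\<exists>\<tau>. topspace \<tau> = X \<and>
               (\<forall>y\<in>Y. lsc_in \<tau> (\<lambda>x. I x y - J x y + \<alpha> x + \<beta> x) \<and>
                       inf_compact_in \<tau> (\<lambda>x. I x y - J x y + \<alpha> x + \<beta> x))"
    and i3: "\<And>x. x \<in> X \<Longrightarrow> continuous_on Y (\<lambda>y. I x y - J x y) \<and>
                              quasi_concave_on Y (\<lambda>y. I x y - J x y)"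
    and i4: "\<And>y u. y \<in> Y \<Longrightarrow> u \<in> X \<Longrightarrow>
               ereal (I u y - J u y + \<alpha> u + \<beta> u)
                 = (INF x\<in>X. ereal (I x y - J x y + \<alpha> x + \<beta> x)) \<Longrightarrow>
               pointwise_invariant X (\<lambda>x. J x y - \<beta> x) (\<lambda>x. I x y + \<alpha> x) u"
  shows "\<forall>S. S \<subseteq> Y \<longrightarrow> convex S \<longrightarrow> Y \<subseteq> closure S \<longrightarrow>
           (\<exists>y\<in>S. \<exists>x1\<in>X. \<exists>x2\<in>X. x1 \<noteq> x2 \<and>
              (\<forall>x\<in>{x1, x2}.
                 gateaux_deriv (\<lambda>x. I x y) x - gateaux_deriv (\<lambda>x. J x y) x
                   + gateaux_deriv \<alpha> x + gateaux_deriv \<beta> x = 0))"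
proof (intro allI impI)
  fix S assume S: "S \<subseteq> Y" "convex S" "Y \<subseteq> closure S"
  define f where "f x y = I x y - J x y + \<alpha> x + \<beta> x" for x y
  \<comment> \<open>This grouping separates the part depending on \<open>y\<close> from the
    perturbation, as in \<open>minimax_gap_add\<close>.\<close>
  have f_alt: "f x y = (I x y - J x y) + (\<alpha> x + \<beta> x)" for x y by (simp add: f_def)
  obtain T where T: "topspace T = X"
    and lsc: "\<And>y. y \<in> Y \<Longrightarrow> lsc_in T (\<lambda>x. f x y)"
    and comp: "\<And>y. y \<in> Y \<Longrightarrow> inf_compact_in T (\<lambda>x. f x y)"
    using i2 unfolding f_def by blast
  have cont: "continuous_on Y (f x)" if "x \<in> X" for x
    using i3[OF that] unfolding f_alt by (auto intro: continuous_on_add continuous_on_const)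
  have qc: "quasi_concave_on Y (f x)" if "x \<in> X" for x
    unfolding quasi_concave_on_def
  proof
    fix \<rho>
    have "{y \<in> Y. \<rho> \<le> f x y} = {y \<in> Y. \<rho> - (\<alpha> x + \<beta> x) \<le> I x y - J x y}"
      by (auto simp: f_def)
    then show "convex {y \<in> Y. \<rho> \<le> f x y}"
      using i3[OF that] by (simp add: quasi_concave_on_def)
  qed
  obtain r where below: "\<And>y. y \<in> Y \<Longrightarrow> \<exists>x\<in>X. f x y < r"
    and above: "\<And>x. x \<in> X \<Longrightarrow> \<exists>y\<in>Y. r < f x y"
    using minimax_gap_add[OF X(3) osc gap] unfolding f_alt by blast
  have "\<exists>y\<in>S. \<exists>x1\<in>topspace T. \<exists>x2\<in>topspace T. x1 \<noteq> x2 \<and>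
    (\<forall>x\<in>topspace T. f x1 y \<le> f x y \<and> f x2 y \<le> f x y)"
  proof (rule exists_two_minimisers)
    fix x assume "x \<in> topspace T"
    then have x: "x \<in> X" by (simp add: T)
    show "continuous_on S (f x)" using cont[OF x] S(1) by (rule continuous_on_subset)
    show "quasi_concave_on S (f x)" using quasi_concave_on_subset[OF qc[OF x] S(2,1)] .
    show "\<exists>y\<in>S. r < f x y"
      using continuous_on_less_dense[OF cont[OF x] S(1,3)] above[OF x] by blast
  next
    fix y assume "y \<in> S"
    then show "\<exists>x\<in>topspace T. f x y \<le> r"
      using below[of y] S(1) by (auto simp: T intro: less_imp_le)
  qed (use S lsc comp T X in auto)
  then obtain y x1 x2 where y: "y \<in> S" and x12: "x1 \<in> X" "x2 \<in> X" "x1 \<noteq> x2"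
    and min: "\<And>x u. x \<in> {x1, x2} \<Longrightarrow> u \<in> X \<Longrightarrow> f x y \<le> f u y"
    unfolding T by blast
  have "y \<in> Y" using y S(1) by blast
  have "gateaux_deriv (\<lambda>x. I x y) x - gateaux_deriv (\<lambda>x. J x y) x
      + gateaux_deriv \<alpha> x + gateaux_deriv \<beta> x = 0" if x: "x \<in> {x1, x2}" for x
  proof -
    have "x \<in> X" using x x12 by blast
    note has = has_gateaux_derivative_gateaux_deriv
    have \<Phi>: "has_gateaux_derivative (\<lambda>x. J x y - \<beta> x)
      (gateaux_deriv (\<lambda>x. J x y) x - gateaux_deriv \<beta> x) x"
      by (intro has_gateaux_derivative_diff has C1_functional_imp_gateaux_differentiable
          J_C1 \<beta>_C1 \<open>y \<in> Y\<close>)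
    have \<Psi>: "has_gateaux_derivative (\<lambda>x. I x y + \<alpha> x)
      (gateaux_deriv (\<lambda>x. I x y) u + gateaux_deriv \<alpha> u) u" if "u \<in> X" for u
      by (intro has_gateaux_derivative_add has I_diff \<alpha>_diff \<open>y \<in> Y\<close> that)
    have "ereal (f x y) = (INF u\<in>X. ereal (f u y))"
      using min[OF x] \<open>x \<in> X\<close> by (intro antisym INF_greatest INF_lower) auto
    then have inv: "pointwise_invariant X (\<lambda>x. J x y - \<beta> x) (\<lambda>x. I x y + \<alpha> x) x"
      using i4 \<open>y \<in> Y\<close> \<open>x \<in> X\<close> unfolding f_def by blast
    \<comment> \<open>With these two functions as \<Phi> and \<Psi>, the difference \<Psi> - \<Phi>
      is \<open>f\<close> at the fixed \<open>y\<close>, so equal derivatives are exactly the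
      required equation.\<close>
    have "gateaux_deriv (\<lambda>x. J x y - \<beta> x) x = gateaux_deriv (\<lambda>x. I x y + \<alpha> x) x"
    proof (rule pointwise_invariant_minimiser_critical[OF X(2) \<open>x \<in> X\<close> _ _ _ _ inv])
      show "I x y + \<alpha> x - (J x y - \<beta> x) \<le> I u y + \<alpha> u - (J u y - \<beta> u)" if "u \<in> X" for u
        using min[OF x that] by (simp add: f_def)
    qed (use \<Phi> \<Psi> i1 \<open>y \<in> Y\<close> gateaux_differentiable_def in blast)+
    then show ?thesis
      using gateaux_deriv_eq[OF \<Phi>] gateaux_deriv_eq[OF \<Psi>[OF \<open>x \<in> X\<close>]]
      by (simp add: algebra_simps)
  qed
  then show "\<exists>y\<in>S. \<exists>x1\<in>X. \<exists>x2\<in>X. x1 \<noteq> x2 \<and>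
      (\<forall>x\<in>{x1, x2}. gateaux_deriv (\<lambda>x. I x y) x - gateaux_deriv (\<lambda>x. J x y) x
        + gateaux_deriv \<alpha> x + gateaux_deriv \<beta> x = 0)"
    using y x12 by blast
qed

end
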